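(* Let $a,b\in\mathbb R$, $c\in\mathbb R\setminus\{0,-1,-2,\dots\}$, and let $z=x+iy$ with $x,y\in\mathbb R\setminus\{0\}$. Assume that $|z|<1$, or that $|z|=1$ and $c-a-b>0$. Then $$\operatorname{Re}\,{}_2F_1(a,b;c;z) = 1+|z|^2\,\frac{ab}{c}\int_0^\infty e^{-xt}\cos(yt)\;{}_2F_2\left(\begin{array}{c}a+1,\,b+1\\ c+1,\,2\end{array};|z|^2t\right)dt,$$ $$\operatorname{Im}\,{}_2F_1(a,b;c;z) = |z|^2\,\frac{ab}{c}\int_0^\infty e^{-xt}\sin(yt)\;{}_2F_2\left(\begin{array}{c}a+1,\,b+1\\ c+1,\,2\end{array};|z|^2t\right)dt.$$
   Context: $(\lambda)_n=\lambda(\lambda+1)\cdots(\lambda+n-1)$, $(\lambda)_0=1$, is the Pochhammer symbol. ${}_2F_1(a,b;c;z)=\sum_{n\ge0}\frac{(a)_n(b)_n}{(c)_n}\frac{z^n}{n!}$ is the Gauss hypergeometric function, and ${}_2F_2\left(\begin{array}{c}a_1,a_2\\ b_1,b_2\end{array};w\right)=\sum_{n\ge0}\frac{(a_1)_n(a_2)_n}{(b_1)_n(b_2)_n}\frac{w^n}{n!}$, which converges for all finite $w$.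
   Formalization: The integrals can diverge under the stated hypotheses (e.g. a=-1, b=c=1, z=-1/2+i/10), so each identity is asserted only when its own integral converges (possibly conditionally); convergence of both is asserted for |z|^2<x. *)

theory Defs
  imports "HOL-Analysis.Analysis"
begin

text \<open>
  The two hypergeometric functions, as sums of their defining series. Being values of
  \<^const>\<open>suminf\<close>, they are meaningful only where the series converges: for the
  Gauss function, when \<open>norm z < 1\<close>, or \<open>norm z = 1\<close> and \<open>Re (c - a - b) > 0\<close>;
  for the second one, at every \<open>w\<close>. No lower parameter may be a non-positive integer.
\<close>

definition hypergeo_2F1 ::
    "'a \<Rightarrow> 'a \<Rightarrow> 'a \<Rightarrow> 'a \<Rightarrow> 'a::{real_normed_field, banach}" where
  "hypergeo_2F1 a b c z =
     (\<Sum>n. pochhammer a n * pochhammer b n / pochhammer c n * (z ^ n / fact n))"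

definition hypergeo_2F2 ::
    "'a \<Rightarrow> 'a \<Rightarrow> 'a \<Rightarrow> 'a \<Rightarrow> 'a \<Rightarrow> 'a::{real_normed_field, banach}" where
  "hypergeo_2F2 a1 a2 b1 b2 w =
     (\<Sum>n. pochhammer a1 n * pochhammer a2 n / (pochhammer b1 n * pochhammer b2 n)
            * (w ^ n / fact n))"

lemma hypergeo_2F1_eq_eval_fps:
  "hypergeo_2F1 a b c z = eval_fps (fps_hypergeo [a, b] [c] 1) z"
  by (simp add: hypergeo_2F1_def eval_fps_def fps_hypergeo_nth mult_ac)

lemma hypergeo_2F2_eq_eval_fps:
  "hypergeo_2F2 a1 a2 b1 b2 w = eval_fps (fps_hypergeo [a1, a2] [b1, b2] 1) w"
  by (simp add: hypergeo_2F2_def eval_fps_def fps_hypergeo_nth mult_ac)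

end

theory Submission
  imports Defs "HOL-Real_Asymp.Real_Asymp"
begin

text \<open>
  Put \<open>r = (norm z)\<^sup>2\<close> and \<open>s = cnj z\<close>, so that \<open>Re s = x\<close> and \<open>r / s = z\<close>. The two integrands are
  the real and the imaginary part of \<open>exp (- s t)\<close> times the generalised hypergeometric function
  at \<open>r t\<close>. As \<open>t\<^sup>n\<close> has the Laplace transform \<open>n! / s\<^sup>n\<^sup>+\<^sup>1\<close>, integration term by term shows that
  \<open>r a b / c\<close> times the integral is the Gauss series at \<open>z\<close> without its constant term
  (lemma \<open>has_integral_laplace_2F2\<close>). The exchange of sum and integral is legitimate if
  \<open>0 < x\<close> and the series of the quotients of Pochhammer symbols converges absolutely at \<open>r / x\<close>.
  This is so for \<open>r < x\<close>, and for every \<open>x > 0\<close> when \<open>a + 1\<close> or \<open>b + 1\<close> is a non-positive integer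
  and the series terminates.

  In the other cases the identities are claimed only for integrals that converge, perhaps
  conditionally, and two different arguments are needed.

  If \<open>x = r\<close>, conditional convergence can occur. The extra factor \<open>exp (- \<epsilon> t)\<close> turns \<open>s\<close> into
  \<open>s + \<epsilon>\<close> and makes the term-by-term argument applicable. By Abel's theorem for integrals
  (lemma \<open>integral_exp_damped_tendsto\<close>) the damped integrals tend to the integral in question, and
  the Gauss function is continuous at \<open>z\<close>, which lies inside the unit disc here.

  If \<open>x < r\<close> and the series does not terminate, its coefficients eventually have constant sign and
  are at least of size \<open>\<kappa> / (n + m)!\<close>. Hence the function grows at least like \<open>e\<^sup>w / w\<^sup>m\<close>, and its product
  with \<open>exp (- x t)\<close> is eventually large and of constant sign (lemma \<open>exp_mult_2F2_eventually_large\<close>). The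
  same holds for \<open>x < 0\<close> if the series terminates, as a non-zero polynomial stays away from zero.
  Multiplied by \<open>cos (y t)\<close> or \<open>sin (y t)\<close> with \<open>y \<noteq> 0\<close>, such a function violates the Cauchy
  criterion (lemma \<open>not_integrable_oscillating\<close>). So neither integral converges, and there is
  nothing to prove.
\<close>

section \<open>Laplace transforms of exponential series\<close>

lemma tendsto_power_mult_exp_complex:
  assumes "0 < Re s"
  shows "((\<lambda>y. of_real y ^ n * exp (- s * of_real y)) \<longlongrightarrow> 0) at_top"
proof (rule tendsto_norm_zero_cancel)
  have "((\<lambda>y. \<bar>y\<bar> ^ n * exp (- Re s * y)) \<longlongrightarrow> 0) at_top"
    using assms by real_asymp
  then show "((\<lambda>y. norm (of_real y ^ n * exp (- s * of_real y))) \<longlongrightarrow> 0) at_top"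
    by (simp add: norm_mult norm_power)
qed

text \<open>
  The Gamma integral for a complex rate \<open>s\<close>. Integrating the derivative of
  \<open>t\<^sup>n\<^sup>+\<^sup>1 e\<^sup>-\<^sup>s\<^sup>t\<close> over \<open>[0, y]\<close> links the integrals of order \<open>n + 1\<close> and \<open>n\<close>, up to a
  boundary term that dies out because \<open>Re s > 0\<close>.
\<close>
lemma integral_power_mult_exp_tendsto:
  fixes s :: complex
  assumes "0 < Re s"
  shows "((\<lambda>y. integral {0..y} (\<lambda>t. of_real t ^ n * exp (- s * of_real t))) \<longlongrightarrow> fact n / s ^ Suc n) at_top"
proof (induction n)
  case 0
  have s: "s \<noteq> 0" using assms by auto
  have exp_integral: "((\<lambda>t. exp (- s * of_real t)) has_integral (- exp (- s * of_real y) / s - (- 1 / s))) {0..y}"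
    if "0 \<le> y" for y
  proof -
    have "((\<lambda>t. exp (- s * of_real t)) has_integral
       (- exp (- s * of_real y) / s - (- exp (- s * of_real 0) / s))) {0..y}"
      using that s by (intro fundamental_theorem_of_calculus has_vector_derivative_real_field)
         (auto intro!: derivative_eq_intros)
    then show ?thesis by simp
  qed
  have ev: "\<forall>\<^sub>F y in at_top. - (of_real y ^ 0 * exp (- s * of_real y)) / s + 1 / s
                  = integral {0..y} (\<lambda>t. of_real t ^ 0 * exp (- s * of_real t))"
    using eventually_ge_at_top[of 0]
  proof eventually_elim
    case (elim y)
    from integral_unique[OF exp_integral[OF elim]] show ?case by simp
  qed
  have "((\<lambda>y. - (of_real y ^ 0 * exp (- s * of_real y)) / s + 1 / s) \<longlongrightarrow> - 0 / s + 1 / s) at_top"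
    using s by (intro tendsto_intros tendsto_power_mult_exp_complex assms)
  from Lim_transform_eventually[OF this ev] show ?case by simp
next
  case (Suc n)
  have s: "s \<noteq> 0" using assms by auto
  let ?I = "\<lambda>n y. integral {0..y} (\<lambda>t. of_real t ^ n * exp (- s * of_real t))"
  have parts: "?I (Suc n) y = of_nat (Suc n) / s * ?I n y
                 - (of_real y ^ Suc n * exp (- s * of_real y)) / s" if "0 \<le> y" for y
  proof -
    have "((\<lambda>t. of_nat (Suc n) * (of_real t ^ n * exp (- s * of_real t))
              - s * (of_real t ^ Suc n * exp (- s * of_real t))) has_integral
          (of_real y ^ Suc n * exp (- s * of_real y) - of_real 0 ^ Suc n * exp (- s * of_real 0))) {0..y}"
      using that by (intro fundamental_theorem_of_calculus has_vector_derivative_real_field)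
         (auto intro!: derivative_eq_intros simp: algebra_simps simp del: power_Suc)
    moreover have "(\<lambda>t. of_real t ^ k * exp (- s * of_real t)) integrable_on {0..y}" for k
      by (intro integrable_continuous_interval continuous_intros)
    then have "((\<lambda>t. of_nat (Suc n) * (of_real t ^ n * exp (- s * of_real t))
              - s * (of_real t ^ Suc n * exp (- s * of_real t))) has_integral
          (of_nat (Suc n) * ?I n y - s * ?I (Suc n) y)) {0..y}"
      by (intro has_integral_diff has_integral_mult_right integrable_integral)
    ultimately have "of_nat (Suc n) * ?I n y - s * ?I (Suc n) y
         = of_real y ^ Suc n * exp (- s * of_real y) - of_real 0 ^ Suc n * exp (- s * of_real 0)"
      by (rule has_integral_unique[symmetric])
    then have "s * ?I (Suc n) y = of_nat (Suc n) * ?I n y - of_real y ^ Suc n * exp (- s * of_real y)"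
      by (simp add: algebra_simps)
    then have "?I (Suc n) y = (of_nat (Suc n) * ?I n y - of_real y ^ Suc n * exp (- s * of_real y)) / s"
      unfolding nonzero_eq_divide_eq[OF s] by (subst mult.commute)
    then show ?thesis by (simp only: diff_divide_distrib times_divide_eq_left)
  qed
  have ev: "\<forall>\<^sub>F y in at_top. of_nat (Suc n) / s * ?I n y
                 - (of_real y ^ Suc n * exp (- s * of_real y)) / s = ?I (Suc n) y"
    using eventually_ge_at_top[of 0] by eventually_elim (rule parts[symmetric])
  have "((\<lambda>y. of_nat (Suc n) / s * ?I n y - (of_real y ^ Suc n * exp (- s * of_real y)) / s)
           \<longlongrightarrow> of_nat (Suc n) / s * (fact n / s ^ Suc n) - 0 / s) at_top"
    by (rule tendsto_diff[OF tendsto_mult[OF tendsto_const Suc.IH]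
          tendsto_divide[OF tendsto_power_mult_exp_complex[OF assms] tendsto_const s]])
  from Lim_transform_eventually[OF this ev] show ?case by simp
qed

text \<open>
  This is the dominating function that lets the limit over \<open>[0, y]\<close> be read as an integral
  over the half-line.
\<close>
lemma integrable_power_mult_exp:
  fixes x :: real
  assumes "0 < x"
  shows "(\<lambda>t. t ^ n * exp (- x * t)) integrable_on {0..}"
proof -
  have "(\<lambda>t. norm (complex_of_real t powr (of_nat (Suc n) - 1) / of_real (exp (x * t)))) integrable_on {0<..}"
    using absolutely_integrable_Gamma_integral[of "of_nat (Suc n)" x] assms
    by (simp add: absolutely_integrable_on_def)
  then have "(\<lambda>t. t ^ n * exp (- x * t)) integrable_on {0<..}"
    by (rule integrable_eq)
       (auto simp: norm_divide norm_power powr_realpow exp_minus field_simps)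
  then show ?thesis
    by (rule integrable_spike_set) (rule negligible_subset[of "{0}"]; auto)+
qed

lemma has_integral_power_mult_exp:
  fixes s :: complex
  assumes "0 < Re s"
  shows "((\<lambda>t. of_real t ^ n * exp (- s * of_real t)) has_integral fact n / s ^ Suc n) {0..}"
proof (rule has_integral_dominated_convergence)
  let ?f = "\<lambda>t. of_real t ^ n * exp (- s * of_real t)"
  show "((\<lambda>t. if t \<in> {0..real k} then ?f t else 0) has_integral integral {0..real k} ?f) {0..}" for k
    by (subst has_integral_restrict)
       (auto intro!: integrable_integral integrable_continuous_interval continuous_intros)
  show "(\<lambda>t. t ^ n * exp (- Re s * t)) integrable_on {0..}"
    by (rule integrable_power_mult_exp) fact
  show "\<forall>t\<in>{0..}. norm (if t \<in> {0..real k} then ?f t else 0) \<le> t ^ n * exp (- Re s * t)" for k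
    by (auto simp: norm_mult norm_power)
  show "\<forall>t\<in>{0..}. (\<lambda>k. if t \<in> {0..real k} then ?f t else 0) \<longlonglongrightarrow> ?f t"
  proof
    fix t :: real assume t: "t \<in> {0..}"
    have "\<forall>\<^sub>F k in sequentially. t \<le> real k"
      by (meson eventually_sequentiallyI nat_ceiling_le_eq)
    then have "\<forall>\<^sub>F k in sequentially. ?f t = (if t \<in> {0..real k} then ?f t else 0)"
      by eventually_elim (use t in auto)
    then show "(\<lambda>k. if t \<in> {0..real k} then ?f t else 0) \<longlonglongrightarrow> ?f t"
      by (rule Lim_transform_eventually[rotated]) simp
  qed
  show "(\<lambda>k. integral {0..real k} ?f) \<longlonglongrightarrow> fact n / s ^ Suc n"
    using integral_power_mult_exp_tendsto[OF assms, of n]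
    by (rule filterlim_compose) (rule filterlim_real_sequentially)
qed

lemma summable_div_power_complex:
  fixes s :: complex and q :: "nat \<Rightarrow> real"
  assumes s: "0 < Re s" and q: "summable (\<lambda>n. \<bar>q n\<bar> / Re s ^ Suc n)"
  shows "summable (\<lambda>n. of_real (q n) / s ^ Suc n)"
proof (rule summable_comparison_test'[OF q])
  fix n
  have "Re s ^ Suc n \<le> norm s ^ Suc n"
    using s complex_Re_le_cmod by (intro power_mono) auto
  then show "norm (of_real (q n) / s ^ Suc n) \<le> \<bar>q n\<bar> / Re s ^ Suc n"
    using s by (simp only: norm_divide norm_power norm_of_real real_norm_def)
       (intro divide_left_mono, auto intro!: mult_pos_pos zero_less_power simp del: power_Suc)
qed

text \<open>
  The Laplace transform inverts the Borel transform: it multiplies the \<open>n\<close>-th coefficient of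
  the exponential series by \<open>n! / s\<^sup>n\<^sup>+\<^sup>1\<close>. The series of absolute values, times
  \<open>exp (- Re s * t)\<close>, is integrable by monotone convergence. It dominates all partial sums, so sum
  and integral may be exchanged.
\<close>
lemma has_integral_laplace_of_exp_series:
  fixes s :: complex and q :: "nat \<Rightarrow> real"
  assumes s: "0 < Re s" and q: "summable (\<lambda>n. \<bar>q n\<bar> / Re s ^ Suc n)"
    and conv: "\<And>t. t \<ge> 0 \<Longrightarrow> summable (\<lambda>n. \<bar>q n\<bar> * (t ^ n / fact n))"
  shows "((\<lambda>t. exp (- s * of_real t) * of_real (\<Sum>n. q n * (t ^ n / fact n)))
           has_integral (\<Sum>n. of_real (q n) / s ^ Suc n)) {0..}"
proof (rule has_integral_dominated_convergence)
  let ?x = "Re s"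
  have real: "((\<lambda>t. t ^ n * exp (- ?x * t)) has_integral fact n / ?x ^ Suc n) {0..}" for n
  proof -
    have "((\<lambda>t. Re (of_real t ^ n * exp (- of_real ?x * of_real t))) has_integral
           Re (fact n / of_real ?x ^ Suc n)) {0..}"
      using has_integral_linear[OF has_integral_power_mult_exp[of "of_real ?x"] bounded_linear_Re] s
      by (simp add: o_def)
    moreover have "Re (of_real t ^ n * exp (- of_real ?x * of_real t)) = t ^ n * exp (- ?x * t)" for t
      by (metis Re_complex_of_real exp_of_real of_real_minus of_real_mult of_real_power)
    moreover have "Re (fact n / of_real ?x ^ Suc n) = fact n / ?x ^ Suc n"
      by (metis Re_complex_of_real of_real_divide of_real_fact of_real_power)
    ultimately show ?thesis by (simp only:)
  qed
  let ?h = "\<lambda>t. exp (- ?x * t) * (\<Sum>n. \<bar>q n\<bar> * (t ^ n / fact n))"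
  have "(?h has_integral (\<Sum>n. \<bar>q n\<bar> / ?x ^ Suc n)) {0..}"
  proof (rule has_integral_monotone_convergence_increasing)
    show "((\<lambda>t. \<Sum>n<k. \<bar>q n\<bar> / fact n * (t ^ n * exp (- ?x * t))) has_integral
            (\<Sum>n<k. \<bar>q n\<bar> / ?x ^ Suc n)) {0..}" for k
    proof (rule has_integral_sum)
      fix n
      show "((\<lambda>t. \<bar>q n\<bar> / fact n * (t ^ n * exp (- ?x * t))) has_integral \<bar>q n\<bar> / ?x ^ Suc n) {0..}"
        using has_integral_mult_right[OF real, of "\<bar>q n\<bar> / fact n" n] by simp
    qed simp
    show "(\<lambda>k. \<Sum>n<k. \<bar>q n\<bar> / ?x ^ Suc n) \<longlonglongrightarrow> (\<Sum>n. \<bar>q n\<bar> / ?x ^ Suc n)"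
      using q by (rule summable_LIMSEQ)
  next
    fix t :: real assume "t \<in> {0..}"
    then have t: "t \<ge> 0" by simp
    show "(\<Sum>n<k. \<bar>q n\<bar> / fact n * (t ^ n * exp (- ?x * t)))
            \<le> (\<Sum>n<Suc k. \<bar>q n\<bar> / fact n * (t ^ n * exp (- ?x * t)))" for k
      using t by simp
    show "(\<lambda>k. \<Sum>n<k. \<bar>q n\<bar> / fact n * (t ^ n * exp (- ?x * t))) \<longlonglongrightarrow> ?h t"
      using sums_mult[OF summable_sums[OF conv[OF t]], of "exp (- ?x * t)"]
      by (simp add: sums_def mult_ac)
  qed
  then show "?h integrable_on {0..}" by blast
  show "((\<lambda>t. \<Sum>n<k. of_real (q n) / fact n * (of_real t ^ n * exp (- s * of_real t))) has_integral
          (\<Sum>n<k. of_real (q n) / s ^ Suc n)) {0..}" for k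
  proof (rule has_integral_sum)
    fix n
    show "((\<lambda>t. of_real (q n) / fact n * (of_real t ^ n * exp (- s * of_real t))) has_integral of_real (q n) / s ^ Suc n) {0..}"
      using has_integral_mult_right[OF has_integral_power_mult_exp[OF s], of "of_real (q n) / fact n" n] by simp
  qed simp
  show "(\<lambda>k. \<Sum>n<k. of_real (q n) / s ^ Suc n) \<longlonglongrightarrow> (\<Sum>n. of_real (q n) / s ^ Suc n)"
    by (rule summable_LIMSEQ summable_div_power_complex s q)+
  show "\<forall>t\<in>{0..}. norm (\<Sum>n<k. of_real (q n) / fact n * (of_real t ^ n * exp (- s * of_real t))) \<le> ?h t" for k
  proof
    fix t :: real assume "t \<in> {0..}"
    then have t: "t \<ge> 0" by simp
    have "norm (\<Sum>n<k. of_real (q n) / fact n * (of_real t ^ n * exp (- s * of_real t)))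
        \<le> (\<Sum>n<k. \<bar>q n\<bar> * (t ^ n / fact n) * exp (- ?x * t))"
      using t by (intro sum_norm_le) (simp add: norm_mult norm_divide norm_power)
    also have "\<dots> = exp (- ?x * t) * (\<Sum>n<k. \<bar>q n\<bar> * (t ^ n / fact n))"
      by (subst sum_distrib_right[symmetric]) (rule mult.commute)
    also have "\<dots> \<le> ?h t"
      using t by (intro mult_left_mono sum_le_suminf conv) auto
    finally show "norm (\<Sum>n<k. of_real (q n) / fact n * (of_real t ^ n * exp (- s * of_real t))) \<le> ?h t" .
  qed
  show "\<forall>t\<in>{0..}. (\<lambda>k. \<Sum>n<k. of_real (q n) / fact n * (of_real t ^ n * exp (- s * of_real t)))
      \<longlonglongrightarrow> exp (- s * of_real t) * of_real (\<Sum>n. q n * (t ^ n / fact n))"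
  proof
    fix t :: real assume "t \<in> {0..}"
    then have t: "t \<ge> 0" by simp
    have sm: "summable (\<lambda>n. q n * (t ^ n / fact n))"
      by (rule summable_norm_cancel) (use conv[OF t] t in \<open>simp add: abs_mult\<close>)
    have "(\<lambda>k. exp (- s * of_real t) * of_real (\<Sum>n<k. q n * (t ^ n / fact n)))
       \<longlonglongrightarrow> exp (- s * of_real t) * of_real (\<Sum>n. q n * (t ^ n / fact n))"
      by (intro tendsto_intros summable_LIMSEQ sm)
    then show "(\<lambda>k. \<Sum>n<k. of_real (q n) / fact n * (of_real t ^ n * exp (- s * of_real t)))
      \<longlonglongrightarrow> exp (- s * of_real t) * of_real (\<Sum>n. q n * (t ^ n / fact n))"
      by (simp add: sum_distrib_left field_simps)
  qed
qed

section \<open>The Laplace transform of the generalised hypergeometric function\<close>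

lemma summable_pochhammer_quotient:
  fixes a1 a2 b1 b2 \<rho> :: real
  assumes "0 \<le> \<rho>" "\<rho> < 1"
  shows "summable (\<lambda>n. \<bar>pochhammer a1 n * pochhammer a2 n / (pochhammer b1 n * pochhammer b2 n)\<bar> * \<rho> ^ n)"
    (is "summable ?f")
proof -
  let ?R = "\<lambda>n. (a1 + real n) * (a2 + real n) / ((b1 + real n) * (b2 + real n))"
  have "?R \<longlonglongrightarrow> 1" by real_asymp
  then have "(\<lambda>n. \<bar>?R n\<bar> * \<rho>) \<longlonglongrightarrow> \<bar>1\<bar> * \<rho>" by (intro tendsto_intros)
  then have "\<forall>\<^sub>F n in sequentially. \<bar>?R n\<bar> * \<rho> < (1 + \<rho>) / 2"
    by (rule order_tendstoD) (use assms in auto)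
  then obtain N where N: "\<And>n. n \<ge> N \<Longrightarrow> \<bar>?R n\<bar> * \<rho> < (1 + \<rho>) / 2"
    by (auto simp: eventually_sequentially)
  show ?thesis
  proof (rule summable_ratio_test)
    show "(1 + \<rho>) / 2 < 1" using assms by simp
    fix n assume "n \<ge> N"
    \<comment> \<open>If a lower Pochhammer symbol vanishes, both sides are \<open>0\<close>, division by zero being \<open>0\<close>.\<close>
    have "?f (Suc n) = (\<bar>?R n\<bar> * \<rho>) * ?f n"
      by (simp add: pochhammer_Suc abs_mult mult_ac)
    also have "\<dots> \<le> (1 + \<rho>) / 2 * ?f n"
      using N[OF \<open>n \<ge> N\<close>] assms by (intro mult_right_mono) auto
    finally show "norm (?f (Suc n)) \<le> (1 + \<rho>) / 2 * norm (?f n)" using assms by simp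
  qed
qed

text \<open>
  Borrowing a factor \<open>2\<^sup>n\<close> from the exponential series leaves the quotients against the geometric
  sequence of ratio \<open>1/2\<close>, where the ratio test applies.
\<close>
lemma summable_2F2:
  fixes a1 a2 b1 b2 w :: real
  assumes "0 \<le> w"
  shows "summable (\<lambda>n. \<bar>pochhammer a1 n * pochhammer a2 n / (pochhammer b1 n * pochhammer b2 n)\<bar> * (w ^ n / fact n))"
    (is "summable (\<lambda>n. \<bar>?Q n\<bar> * _)")
proof (rule summable_comparison_test')
  show "summable (\<lambda>n. exp (2 * w) * (\<bar>?Q n\<bar> * (1/2) ^ n))"
    by (intro summable_mult summable_pochhammer_quotient) auto
  fix n
  have "(2 * w) ^ n / fact n \<le> exp (2 * w)"
  proof -
    have "(\<Sum>k\<in>{n}. (2 * w) ^ k /\<^sub>R fact k) \<le> (\<Sum>k. (2 * w) ^ k /\<^sub>R fact k)"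
      using assms by (intro sum_le_suminf summable_exp_generic) auto
    then show ?thesis by (simp add: exp_def divide_inverse mult.commute)
  qed
  then have "\<bar>?Q n\<bar> * (1/2) ^ n * ((2 * w) ^ n / fact n) \<le> \<bar>?Q n\<bar> * (1/2) ^ n * exp (2 * w)"
    by (intro mult_left_mono) auto
  then show "norm (\<bar>?Q n\<bar> * (w ^ n / fact n)) \<le> exp (2 * w) * (\<bar>?Q n\<bar> * (1/2) ^ n)"
    using assms by (simp add: power_mult_distrib power_one_over field_simps)
qed

text \<open>
  The lower parameter \<open>2\<close> has \<open>(2)\<^sub>n = (n + 1)!\<close>, and \<open>(a)\<^sub>n\<^sub>+\<^sub>1 = a (a + 1)\<^sub>n\<close>. So, after the Laplace
  transform, the \<open>n\<close>-th term is the \<open>(n + 1)\<close>-st term of the Gauss series at \<open>r / s\<close>, up to the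
  factor \<open>r a b / c\<close>; only the constant term \<open>1\<close> of the Gauss series is left over.
\<close>
lemma has_integral_laplace_2F2:
  fixes a b c r :: real and s :: complex
  assumes s: "0 < Re s" and "0 \<le> r"
    and Q: "summable (\<lambda>n. \<bar>pochhammer (a + 1) n * pochhammer (b + 1) n / (pochhammer (c + 1) n * pochhammer 2 n)\<bar> * (r / Re s) ^ n)"
      (is "summable (\<lambda>n. \<bar>?Q n\<bar> * _)")
  obtains J where
    "((\<lambda>t. exp (- s * of_real t) * of_real (hypergeo_2F2 (a + 1) (b + 1) (c + 1) 2 (r * t))) has_integral J) {0..}"
    "hypergeo_2F1 (of_real a) (of_real b) (of_real c) (of_real r / s) = 1 + of_real (r * (a * b / c)) * J"
proof -
  let ?q = "\<lambda>n. ?Q n * r ^ n"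
  let ?J = "\<Sum>n. of_real (?q n) / s ^ Suc n"
  have q: "summable (\<lambda>n. \<bar>?q n\<bar> / Re s ^ Suc n)"
    using summable_mult[OF Q, of "1 / Re s"] \<open>0 \<le> r\<close>
    by (simp add: abs_mult power_divide field_simps)
  have "((\<lambda>t. exp (- s * of_real t) * of_real (\<Sum>n. ?q n * (t ^ n / fact n))) has_integral ?J) {0..}"
  proof (rule has_integral_laplace_of_exp_series[OF s q])
    fix t :: real assume "t \<ge> 0"
    then show "summable (\<lambda>n. \<bar>?q n\<bar> * (t ^ n / fact n))"
      using summable_2F2[of "r * t"] \<open>0 \<le> r\<close> by (simp add: abs_mult power_mult_distrib mult_ac)
  qed
  moreover have "(\<Sum>n. ?q n * (t ^ n / fact n)) = hypergeo_2F2 (a + 1) (b + 1) (c + 1) 2 (r * t)" for t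
    by (simp add: hypergeo_2F2_def power_mult_distrib mult_ac)
  ultimately have int: "((\<lambda>t. exp (- s * of_real t) * of_real (hypergeo_2F2 (a + 1) (b + 1) (c + 1) 2 (r * t))) has_integral ?J) {0..}"
    by (simp only:)
  let ?F = "\<lambda>n. pochhammer (of_real a) n * pochhammer (of_real b) n / pochhammer (of_real c) n * ((of_real r / s) ^ n / fact n)"
  have shift: "?F (Suc n) = of_real (r * (a * b / c)) * (of_real (?q n) / s ^ Suc n)" for n
  proof -
    have "fact (Suc n) = pochhammer (2::complex) n"
      using pochhammer_rec[of "1::complex" n] by (simp only: pochhammer_fact one_add_one mult_1)
    then show ?thesis
      by (simp only: pochhammer_rec)
        (simp add: pochhammer_of_real[symmetric] power_divide mult_ac)
  qed
  have "(\<lambda>n. of_real (r * (a * b / c)) * (of_real (?q n) / s ^ Suc n)) sums (of_real (r * (a * b / c)) * ?J)"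
    by (intro sums_mult summable_sums summable_div_power_complex s q)
  then have "(\<lambda>n. ?F (Suc n)) sums (of_real (r * (a * b / c)) * ?J)"
    by (simp only: shift)
  then have "?F sums (of_real (r * (a * b / c)) * ?J + ?F 0)"
    by (rule sums_Suc)
  then have "hypergeo_2F1 (of_real a) (of_real b) (of_real c) (of_real r / s) = of_real (r * (a * b / c)) * ?J + ?F 0"
    unfolding hypergeo_2F1_def by (rule sums_unique[symmetric])
  moreover have "?F 0 = 1" by simp
  ultimately show thesis by (intro that[OF int]) (simp only: add.commute)
qed

section \<open>Conditionally convergent integrals over a half-line\<close>

text \<open>
  The easy half of Hake's theorem: integrability over \<open>[a, \<infinity>)\<close> in the Henstock--Kurzweil sense,
  which does not ask for absolute convergence, implies improper convergence.
\<close>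
lemma integral_Ici_tendsto:
  fixes f :: "real \<Rightarrow> real"
  assumes "f integrable_on {a..}"
  shows "((\<lambda>T. integral {a..T} f) \<longlongrightarrow> integral {a..} f) at_top"
proof (rule tendstoI)
  fix e :: real assume "0 < e"
  let ?g = "\<lambda>x. if x \<in> {a..} then f x else 0"
  obtain B where B: "\<And>l u. ball 0 B \<subseteq> cbox l u \<Longrightarrow> norm (integral (cbox l u) ?g - integral {a..} f) < e"
    using integrable_integral[OF assms] \<open>0 < e\<close> unfolding has_integral_alt' by meson
  show "\<forall>\<^sub>F T in at_top. dist (integral {a..T} f) (integral {a..} f) < e"
    using eventually_ge_at_top[of B]
  proof eventually_elim
    case (elim T)
    have "integral (cbox (min a (- B)) T) ?g = integral ({a..} \<inter> cbox (min a (- B)) T) f"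
      by (rule Henstock_Kurzweil_Integration.integral_restrict_Int)
    also have "{a..} \<inter> cbox (min a (- B)) T = {a..T}" by auto
    finally show ?case
      using B[of "min a (- B)" T] elim by (force simp: dist_norm)
  qed
qed

lemma integral_Ici_tail:
  fixes f :: "real \<Rightarrow> real"
  assumes f: "f integrable_on {a..}" and "0 < e"
  obtains B where "a \<le> B" "\<And>S T. B \<le> S \<Longrightarrow> S \<le> T \<Longrightarrow> \<bar>integral {S..T} f\<bar> < e"
proof -
  have "\<forall>\<^sub>F T in at_top. dist (integral {a..T} f) (integral {a..} f) < e / 2"
    using tendstoD[OF integral_Ici_tendsto[OF f], of "e / 2"] \<open>0 < e\<close> by simp
  then obtain B where B: "\<And>T. T \<ge> B \<Longrightarrow> dist (integral {a..T} f) (integral {a..} f) < e / 2"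
    by (auto simp: eventually_at_top_linorder)
  show thesis
  proof (rule that[of "max a B"])
    fix S T assume ST: "max a B \<le> S" "S \<le> T"
    have "f integrable_on {a..T}"
      by (rule integrable_on_subinterval[OF f]) auto
    then have "integral {a..S} f + integral {S..T} f = integral {a..T} f"
      using ST by (intro Henstock_Kurzweil_Integration.integral_combine) auto
    then show "\<bar>integral {S..T} f\<bar> < e"
      using B[of S] B[of T] ST unfolding dist_real_def by linarith
  qed simp
qed

text \<open>
  Abel's theorem for integrals. As \<open>f\<close> need not be absolutely integrable, dominated convergence
  is not available; instead the monotone weight \<open>1 - e\<^sup>-\<^sup>\<epsilon>\<^sup>t\<close>, which lies in \<open>[0, 1]\<close>, is removed by the
  second mean value theorem. On a fixed initial segment the weight is uniformly small, and
  beyond it the integrals of \<open>f\<close> itself are small.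
\<close>
lemma integral_exp_damped_tendsto:
  fixes f :: "real \<Rightarrow> real"
  assumes f: "f integrable_on {0..}"
    and damped: "\<And>\<epsilon>. \<epsilon> > 0 \<Longrightarrow> (\<lambda>t. exp (- \<epsilon> * t) * f t) integrable_on {0..}"
  shows "((\<lambda>\<epsilon>. integral {0..} (\<lambda>t. exp (- \<epsilon> * t) * f t)) \<longlongrightarrow> integral {0..} f) (at_right 0)"
proof (rule tendstoI)
  fix e :: real assume "0 < e"
  obtain B where B: "0 \<le> B" and tail: "\<And>S T. B \<le> S \<Longrightarrow> S \<le> T \<Longrightarrow> \<bar>integral {S..T} f\<bar> < e / 8"
    using integral_Ici_tail[OF f, of "e / 8"] \<open>0 < e\<close> by auto
  have fI: "f integrable_on {S..T}" if "0 \<le> S" for S T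
    by (rule integrable_on_subinterval[OF f]) (use that in auto)
  have "bounded ((\<lambda>T. integral {0..T} f) ` {0..B})"
    by (intro compact_imp_bounded compact_continuous_image indefinite_integral_continuous_1 fI) auto
  then obtain M where "\<forall>T\<in>{0..B}. \<bar>integral {0..T} f\<bar> \<le> M"
    by (auto simp: bounded_iff)
  then have M: "\<bar>integral {0..T} f\<bar> \<le> M" if "0 \<le> T" "T \<le> B" for T
    using that by simp
  have "((\<lambda>\<epsilon>. (1 - exp (- \<epsilon> * B)) * (2 * M)) \<longlongrightarrow> (1 - exp (- 0 * B)) * (2 * M)) (at_right 0)"
    by (intro tendsto_intros)
  then have "\<forall>\<^sub>F \<epsilon> in at_right 0. (1 - exp (- \<epsilon> * B)) * (2 * M) < e / 2"
    by (rule order_tendstoD) (use \<open>0 < e\<close> in auto)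
  then show "\<forall>\<^sub>F \<epsilon> in at_right 0. dist (integral {0..} (\<lambda>t. exp (- \<epsilon> * t) * f t)) (integral {0..} f) < e"
    using eventually_at_right_less
  proof eventually_elim
    case (elim \<epsilon>)
    let ?g = "\<lambda>t. 1 - exp (- \<epsilon> * t)"
    let ?k = "\<lambda>t. ?g t * f t"
    have g: "?g x \<le> ?g y" if "l \<le> x" "x \<le> y" "y \<le> u" for l u x y :: real
      using that elim by simp
    have g01: "0 \<le> ?g t" "?g t \<le> 1" if "0 \<le> t" for t using that elim by auto
    have k_eq: "?k = (\<lambda>t. f t - exp (- \<epsilon> * t) * f t)" by (simp add: algebra_simps)
    have kI: "?k integrable_on {0..}"
      unfolding k_eq using f damped[OF elim(2)] by (rule integrable_diff)
    have kI': "?k integrable_on {S..T}" if "0 \<le> S" for S T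
      by (rule integrable_on_subinterval[OF kI]) (use that in auto)
    have head: "\<bar>integral {0..B} ?k\<bar> \<le> ?g B * (2 * M)"
    proof -
      obtain \<xi> where \<xi>: "\<xi> \<in> {0..B}"
        and eq: "integral {0..B} ?k = ?g 0 * integral {0..\<xi>} f + ?g B * integral {\<xi>..B} f"
        by (rule second_mean_value_theorem[where g = ?g, OF fI[OF order_refl] B g])
      have "integral {0..\<xi>} f + integral {\<xi>..B} f = integral {0..B} f"
        using \<xi> by (intro Henstock_Kurzweil_Integration.integral_combine fI) auto
      then have "\<bar>integral {\<xi>..B} f\<bar> \<le> 2 * M"
        using M[of \<xi>] M[of B] \<xi> B by simp
      then have "?g B * \<bar>integral {\<xi>..B} f\<bar> \<le> ?g B * (2 * M)"
        using g01(1)[OF B] by (rule mult_left_mono)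
      moreover have "\<bar>integral {0..B} ?k\<bar> = ?g B * \<bar>integral {\<xi>..B} f\<bar>"
        unfolding eq using abs_of_nonneg[OF g01(1)[OF B]] by (simp add: abs_mult)
      ultimately show ?thesis by (simp only:)
    qed
    have tail_k: "\<bar>integral {B..T} ?k\<bar> \<le> e / 4" if BT: "B \<le> T" for T
    proof -
      obtain \<xi> where \<xi>: "\<xi> \<in> {B..T}"
        and eq: "integral {B..T} ?k = ?g B * integral {B..\<xi>} f + ?g T * integral {\<xi>..T} f"
        by (rule second_mean_value_theorem[where g = ?g, OF fI[OF B] BT g])
      have small: "\<bar>u * v\<bar> \<le> e / 8" if "0 \<le> u" "u \<le> 1" "\<bar>v\<bar> < e / 8" for u v :: real
      proof -
        have "\<bar>u * v\<bar> \<le> \<bar>v\<bar>"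
          unfolding abs_mult using that by (intro mult_left_le_one_le) auto
        then show ?thesis using that by linarith
      qed
      have "0 \<le> T" using B BT by linarith
      then have "\<bar>?g B * integral {B..\<xi>} f\<bar> \<le> e / 8" "\<bar>?g T * integral {\<xi>..T} f\<bar> \<le> e / 8"
        using \<xi> by (auto simp only: atLeastAtMost_iff intro!: small[OF g01] B tail)
      then show ?thesis unfolding eq by linarith
    qed
    have "\<forall>\<^sub>F T in at_top. \<bar>integral {0..T} ?k\<bar> \<le> ?g B * (2 * M) + e / 4"
      using eventually_ge_at_top[of B]
    proof eventually_elim
      case (elim T)
      have "integral {0..B} ?k + integral {B..T} ?k = integral {0..T} ?k"
        using B elim by (intro Henstock_Kurzweil_Integration.integral_combine kI') auto
      then show ?case using head tail_k[OF elim] by linarith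
    qed
    moreover have "((\<lambda>T. \<bar>integral {0..T} ?k\<bar>) \<longlongrightarrow> \<bar>integral {0..} ?k\<bar>) at_top"
      by (rule tendsto_rabs[OF integral_Ici_tendsto]) (rule kI)
    ultimately have "\<bar>integral {0..} ?k\<bar> \<le> ?g B * (2 * M) + e / 4"
      by (intro tendsto_upperbound[of "\<lambda>T. \<bar>integral {0..T} ?k\<bar>" _ at_top]) auto
    then have "\<bar>integral {0..} ?k\<bar> < e" using elim(1) \<open>0 < e\<close> by linarith
    then show ?case
      unfolding k_eq integral_diff[OF f damped[OF elim(2)]] dist_real_def
      by (subst abs_minus_commute)
  qed
qed

text \<open>
  Around each translate of \<open>t0\<close> by a multiple of the period there is an interval of the same
  length on which the integrand stays above a fixed positive constant. This contradicts the
  Cauchy criterion.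
\<close>
lemma not_integrable_oscillating:
  fixes u \<phi> :: "real \<Rightarrow> real"
  assumes "isCont u t0" "0 < u t0" and p: "0 < p" "\<And>t. u (t + p) = u t"
    and \<phi>: "\<forall>\<^sub>F t in at_top. 1 \<le> \<phi> t"
  shows "\<not> (\<lambda>t. u t * \<phi> t) integrable_on {0..}"
proof
  let ?f = "\<lambda>t. u t * \<phi> t"
  assume f: "?f integrable_on {0..}"
  define m where "m = u t0 / 2"
  have m: "0 < m" "m < u t0" using \<open>0 < u t0\<close> by (auto simp: m_def)
  have "\<forall>\<^sub>F t in at t0. m < u t"
    using \<open>isCont u t0\<close> m by (intro order_tendstoD) (auto simp: isCont_def)
  then obtain d where d: "0 < d" "\<And>t. \<bar>t - t0\<bar> < d \<Longrightarrow> m < u t"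
    using m by (auto simp: eventually_at dist_real_def) metis
  have per: "u (t + real k * p) = u t" for t k
  proof (induction k)
    case (Suc k)
    then show ?case using p(2)[of "t + real k * p"] by (simp add: algebra_simps)
  qed simp
  obtain B where B: "0 \<le> B" "\<And>S T. B \<le> S \<Longrightarrow> S \<le> T \<Longrightarrow> \<bar>integral {S..T} ?f\<bar> < m * (d / 2)"
    using integral_Ici_tail[OF f, of "m * (d / 2)"] m d by auto
  obtain A where A: "\<And>t. t \<ge> A \<Longrightarrow> 1 \<le> \<phi> t"
    using \<phi> by (auto simp: eventually_at_top_linorder)
  obtain k where k: "max A B - t0 < real k * p"
    using reals_Archimedean3[OF p(1)] by blast
  let ?S = "t0 + real k * p"
  have "m * (d / 2) \<le> integral {?S..?S + d / 2} ?f"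
  proof -
    have "?f integrable_on {?S..?S + d / 2}"
      by (rule integrable_on_subinterval[OF f]) (use k B in auto)
    moreover have "m \<le> ?f t" if "t \<in> {?S..?S + d / 2}" for t
    proof -
      have "m < u (t - real k * p)" using that d by auto
      also have "\<dots> = u t" using per[of "t - real k * p" k] by simp
      finally have "m * 1 \<le> u t * \<phi> t"
        using A[of t] that k m by (intro mult_mono) auto
      then show ?thesis by simp
    qed
    ultimately have "integral {?S..?S + d / 2} (\<lambda>_. m) \<le> integral {?S..?S + d / 2} ?f"
      by (intro integral_le) auto
    then show ?thesis using d by (simp add: mult.commute)
  qed
  moreover have "\<bar>integral {?S..?S + d / 2} ?f\<bar> < m * (d / 2)"
    using k d by (intro B) auto
  ultimately show False by linarith
qed

text \<open>
  The sign \<open>\<sigma>\<close> covers functions that are eventually negative, as happens when the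
  coefficients of the hypergeometric series are eventually negative.
\<close>
lemma not_integrable_trig_mult:
  fixes \<phi> :: "real \<Rightarrow> real" and y :: real
  assumes "y \<noteq> 0" "\<sigma> \<in> {1, -1}" and \<phi>: "\<forall>\<^sub>F t in at_top. 1 \<le> \<sigma> * \<phi> t"
  shows "\<not> (\<lambda>t. cos (y * t) * \<phi> t) integrable_on {0..}"
    and "\<not> (\<lambda>t. sin (y * t) * \<phi> t) integrable_on {0..}"
proof -
  have main: "\<not> (\<lambda>t. u (y * t) * \<phi> t) integrable_on {0..}"
    if u: "\<And>s. isCont u s" "\<And>s. u (s + 2 * pi) = u s" "0 < u s0" for u :: "real \<Rightarrow> real" and s0
  proof
    assume "(\<lambda>t. u (y * t) * \<phi> t) integrable_on {0..}"
    then have "(\<lambda>t. \<sigma> * (u (y * t) * \<phi> t)) integrable_on {0..}"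
      by (intro integrable_on_mult_right)
    moreover have "\<not> (\<lambda>t. u (y * t) * (\<sigma> * \<phi> t)) integrable_on {0..}"
    proof (rule not_integrable_oscillating[OF _ _ _ _ \<phi>])
      show "isCont (\<lambda>t. u (y * t)) (s0 / y)"
        by (intro isCont_o2[OF _ u(1)] continuous_intros)
      show "0 < u (y * (s0 / y))" using \<open>y \<noteq> 0\<close> u by simp
      show "0 < 2 * pi / \<bar>y\<bar>" using \<open>y \<noteq> 0\<close> by simp
      fix t
      have "y * (t + 2 * pi / \<bar>y\<bar>) = y * t + sgn y * (2 * pi)"
        using \<open>y \<noteq> 0\<close> by (simp add: sgn_real_def field_simps)
      then show "u (y * (t + 2 * pi / \<bar>y\<bar>)) = u (y * t)"
        using u(2)[of "y * t"] u(2)[of "y * t - 2 * pi"] by (simp add: sgn_real_def split: if_splits)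
    qed
    ultimately show False by (simp add: mult_ac)
  qed
  show "\<not> (\<lambda>t. cos (y * t) * \<phi> t) integrable_on {0..}"
    by (rule main[of cos 0]) auto
  show "\<not> (\<lambda>t. sin (y * t) * \<phi> t) integrable_on {0..}"
    by (rule main[of sin "pi / 2"]) auto
qed

section \<open>Growth of the generalised hypergeometric function\<close>

text \<open>
  Multiplication by \<open>w\<^sup>m\<close> aligns the lower bounds \<open>\<kappa> / (n + m)!\<close> with a tail of the exponential
  series. The terms below \<open>N\<close> and the missing head of the exponential series form a polynomial,
  which costs at most half of \<open>\<kappa> e\<^sup>w\<close> in the end.
\<close>
lemma power_series_exp_growth:
  fixes h :: "nat \<Rightarrow> real"
  assumes conv: "\<And>w. 0 \<le> w \<Longrightarrow> summable (\<lambda>n. h n * w ^ n)"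
    and "0 < \<kappa>" and low: "\<And>n. n \<ge> N \<Longrightarrow> \<kappa> / fact (n + m) \<le> h n"
  shows "\<forall>\<^sub>F w in at_top. \<kappa> / 2 * exp w \<le> w ^ m * (\<Sum>n. h n * w ^ n)"
proof -
  let ?d = "\<lambda>n. h n - \<kappa> / fact (n + m)"
  let ?P = "\<lambda>w. (\<Sum>n<N. ?d n * w ^ (n + m)) - \<kappa> * (\<Sum>k<m. w ^ k / fact k)"
  have bound: "\<kappa> * exp w + ?P w \<le> w ^ m * (\<Sum>n. h n * w ^ n)" if "0 \<le> w" for w
  proof -
    have "(\<lambda>k. w ^ k / fact k) sums exp w"
      using exp_converges[of w] by (simp add: divide_inverse mult.commute)
    from sums_split_initial_segment[OF this, of m]
    have e: "(\<lambda>n. w ^ (n + m) / fact (n + m)) sums (exp w - (\<Sum>k<m. w ^ k / fact k))" .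
    have "(\<lambda>n. w ^ m * (h n * w ^ n)) sums (w ^ m * (\<Sum>n. h n * w ^ n))"
      by (intro sums_mult summable_sums conv that)
    from sums_diff[OF this sums_mult[OF e, of \<kappa>]]
    have d: "(\<lambda>n. ?d n * w ^ (n + m)) sums
        (w ^ m * (\<Sum>n. h n * w ^ n) - \<kappa> * (exp w - (\<Sum>k<m. w ^ k / fact k)))"
      by (simp add: power_add algebra_simps)
    have "(\<Sum>n<N. ?d n * w ^ (n + m)) \<le> (\<Sum>n. ?d n * w ^ (n + m))"
      using that low sums_summable[OF d] by (intro sum_le_suminf) auto
    then show ?thesis
      unfolding sums_unique[OF d, symmetric] by (simp add: algebra_simps)
  qed
  have lim0: "((\<lambda>w. w ^ k / exp w) \<longlongrightarrow> (0::real)) at_top" for k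
    by (rule tendsto_power_div_exp_0)
  have "((\<lambda>w. (\<Sum>n<N. ?d n * (w ^ (n + m) / exp w)) - \<kappa> * (\<Sum>k<m. (w ^ k / exp w) / fact k))
           \<longlongrightarrow> (\<Sum>n<N. ?d n * 0) - \<kappa> * (\<Sum>k<m. 0 / fact k)) at_top"
    by (intro tendsto_diff tendsto_mult tendsto_const tendsto_sum tendsto_divide lim0) auto
  then have "((\<lambda>w. ?P w / exp w) \<longlongrightarrow> 0) at_top"
    by (simp add: diff_divide_distrib sum_divide_distrib sum_distrib_left mult_ac)
  then have "\<forall>\<^sub>F w in at_top. - (\<kappa> / 2) < ?P w / exp w"
    by (rule order_tendstoD) (use \<open>0 < \<kappa>\<close> in simp)
  then show ?thesis
    using eventually_ge_at_top[of 0]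
  proof eventually_elim
    case (elim w)
    have "- (\<kappa> / 2) * exp w \<le> ?P w"
      using elim(1) by (simp add: less_divide_eq)
    then show ?case using bound[OF elim(2)] by linarith
  qed
qed

lemma pochhammer_nonzero:
  fixes a :: real
  assumes "a \<notin> \<int>\<^sub>\<le>\<^sub>0"
  shows "pochhammer a n \<noteq> 0"
  using assms by (auto simp: pochhammer_eq_0_iff)

text \<open>
  The coefficients behave like a power of \<open>n\<close> divided by \<open>n!\<close>, but an inequality suffices. For
  \<open>m\<close> large, the coefficients times \<open>(n + m)!\<close> have ratios eventually at least \<open>1\<close>, so they
  keep their sign and do not decrease in absolute value.
\<close>
lemma coeff_2F2_lower_bound:
  fixes a1 a2 b1 b2 :: real
  assumes "a1 \<notin> \<int>\<^sub>\<le>\<^sub>0" "a2 \<notin> \<int>\<^sub>\<le>\<^sub>0" "b1 \<notin> \<int>\<^sub>\<le>\<^sub>0" "b2 \<notin> \<int>\<^sub>\<le>\<^sub>0"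
  obtains \<sigma> \<kappa> :: real and m N :: nat where "\<sigma> \<in> {1, -1}" "0 < \<kappa>"
    "\<And>n. n \<ge> N \<Longrightarrow> \<kappa> / fact (n + m)
       \<le> \<sigma> * (pochhammer a1 n * pochhammer a2 n / (pochhammer b1 n * pochhammer b2 n) / fact n)"
proof -
  let ?h = "\<lambda>n. pochhammer a1 n * pochhammer a2 n / (pochhammer b1 n * pochhammer b2 n) / fact n"
  \<comment> \<open>The cubic terms of \<open>?num\<close> and \<open>?den\<close> cancel; this choice of \<open>m\<close> makes the quadratic
     coefficient of the difference positive.\<close>
  obtain m where m: "b1 + b2 - a1 - a2 < real m" using reals_Archimedean2 by blast
  let ?num = "\<lambda>n. (a1 + real n) * (a2 + real n) * (real n + 1 + real m)"
  let ?den = "\<lambda>n. (b1 + real n) * (b2 + real n) * (real n + 1)"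
  define d where "d = a1 + a2 + real m - b1 - b2"
  have "0 < d" using m by (simp add: d_def)
  define e where "e = a1 * a2 + (a1 + a2) * (1 + real m) - b1 * b2 - b1 - b2"
  define f where "f = a1 * a2 * (1 + real m) - b1 * b2"
  have num_den: "?num n - ?den n = d * real n ^ 2 + e * real n + f" for n
    by (simp add: d_def e_def f_def algebra_simps power2_eq_square power3_eq_cube)
  have "\<forall>\<^sub>F n in sequentially. 0 < d * real n ^ 2 + e * real n + f"
    using \<open>0 < d\<close> by real_asymp
  moreover have "\<forall>\<^sub>F n in sequentially. 0 < ?den n" by real_asymp
  ultimately have "\<forall>\<^sub>F n in sequentially. 1 \<le> ?num n / ?den n"
    unfolding num_den[symmetric] by eventually_elim (simp add: le_divide_eq)
  then obtain N where N: "\<And>n. n \<ge> N \<Longrightarrow> 1 \<le> ?num n / ?den n"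
    by (auto simp: eventually_sequentially)
  define \<sigma> where "\<sigma> = sgn (?h N)"
  let ?u = "\<lambda>n. \<sigma> * ?h n * fact (n + m)"
  have h: "?h n \<noteq> 0" for n using assms by (simp add: pochhammer_nonzero)
  have "\<sigma> * ?h N = \<bar>?h N\<bar>" unfolding \<sigma>_def abs_sgn by (rule mult.commute)
  then have "0 < \<sigma> * ?h N" using h[of N] by (simp only: zero_less_abs_iff) simp
  then have "0 < ?u N" by (rule mult_pos_pos) (rule fact_gt_zero)
  have ratio: "?u (Suc n) = ?num n / ?den n * ?u n" for n
    by (simp add: pochhammer_Suc field_simps)
  have mono: "?u N \<le> ?u n" if "n \<ge> N" for n
    using that
  proof (induction n rule: dec_induct)
    case (step n)
    have "1 * ?u n \<le> ?num n / ?den n * ?u n"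
      using N[of n] step \<open>0 < ?u N\<close> by (intro mult_right_mono) auto
    then show ?case using step.IH ratio[of n] by simp
  qed simp
  show thesis
  proof (rule that)
    show "\<sigma> \<in> {1, -1}" using h[of N] by (auto simp: \<sigma>_def sgn_real_def)
    show "0 < ?u N" by fact
    show "?u N / fact (n + m) \<le> \<sigma> * ?h n" if "n \<ge> N" for n
      using mono[OF that] by (simp only: pos_divide_le_eq fact_gt_zero)
  qed
qed

text \<open>
  The function grows at least like \<open>e\<^sup>r\<^sup>t / t\<^sup>m\<close> in absolute value, which beats \<open>e\<^sup>x\<^sup>t\<close> when \<open>x < r\<close>.
\<close>
lemma exp_mult_2F2_eventually_large:
  fixes a1 a2 b1 b2 x r :: real
  assumes par: "a1 \<notin> \<int>\<^sub>\<le>\<^sub>0" "a2 \<notin> \<int>\<^sub>\<le>\<^sub>0" "b1 \<notin> \<int>\<^sub>\<le>\<^sub>0" "b2 \<notin> \<int>\<^sub>\<le>\<^sub>0"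
    and "0 < r" "x < r"
  obtains \<sigma> :: real where "\<sigma> \<in> {1, -1}"
    "\<forall>\<^sub>F t in at_top. 1 \<le> \<sigma> * (exp (- x * t) * hypergeo_2F2 a1 a2 b1 b2 (r * t))"
proof -
  let ?Q = "\<lambda>n. pochhammer a1 n * pochhammer a2 n / (pochhammer b1 n * pochhammer b2 n)"
  obtain \<sigma> \<kappa> :: real and m N :: nat where \<sigma>: "\<sigma> \<in> {1, -1}" and "0 < \<kappa>"
    and low: "\<And>n. n \<ge> N \<Longrightarrow> \<kappa> / fact (n + m) \<le> \<sigma> * (?Q n / fact n)"
    by (rule coeff_2F2_lower_bound[OF par], rule that)
  have H: "(\<lambda>n. \<sigma> * (?Q n / fact n) * w ^ n) sums (\<sigma> * hypergeo_2F2 a1 a2 b1 b2 w)" if "0 \<le> w" for w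
  proof -
    have "summable (\<lambda>n. ?Q n * (w ^ n / fact n))"
      by (rule summable_norm_cancel)
         (use summable_2F2[OF that, of a1 a2 b1 b2] that in \<open>simp add: abs_mult\<close>)
    from sums_mult[OF summable_sums[OF this], of \<sigma>] show ?thesis
      unfolding hypergeo_2F2_def by (simp add: mult_ac)
  qed
  have "\<forall>\<^sub>F w in at_top. \<kappa> / 2 * exp w \<le> w ^ m * (\<Sum>n. \<sigma> * (?Q n / fact n) * w ^ n)"
    using sums_summable[OF H] \<open>0 < \<kappa>\<close> low by (rule power_series_exp_growth)
  moreover have "filterlim (\<lambda>t. r * t) at_top at_top" using \<open>0 < r\<close> by real_asymp
  ultimately have "\<forall>\<^sub>F t in at_top. \<kappa> / 2 * exp (r * t) \<le> (r * t) ^ m * (\<Sum>n. \<sigma> * (?Q n / fact n) * (r * t) ^ n)"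
    by (rule eventually_compose_filterlim)
  moreover have "\<forall>\<^sub>F t in at_top. (r * t) ^ m \<le> exp (- x * t) * (\<kappa> / 2 * exp (r * t))"
  proof -
    have "0 < r - x" using \<open>x < r\<close> by simp
    then have "\<forall>\<^sub>F t in at_top. (r * t) ^ m \<le> \<kappa> / 2 * exp ((r - x) * t)"
      using \<open>0 < r\<close> \<open>0 < \<kappa>\<close> by real_asymp
    moreover have "exp (- x * t) * (\<kappa> / 2 * exp (r * t)) = \<kappa> / 2 * exp ((r - x) * t)" for t
      by (simp add: algebra_simps flip: exp_add)
    ultimately show ?thesis by (simp only:)
  qed
  ultimately have "\<forall>\<^sub>F t in at_top. 1 \<le> \<sigma> * (exp (- x * t) * hypergeo_2F2 a1 a2 b1 b2 (r * t))"
    using eventually_gt_at_top[of 0]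
  proof eventually_elim
    case (elim t)
    let ?H = "\<sigma> * hypergeo_2F2 a1 a2 b1 b2 (r * t)"
    have rt: "0 < (r * t) ^ m" using elim(3) \<open>0 < r\<close> by simp
    have "(\<Sum>n. \<sigma> * (?Q n / fact n) * (r * t) ^ n) = ?H"
      using elim(3) \<open>0 < r\<close> by (intro sums_unique[symmetric] H) simp
    then have "exp (- x * t) * (\<kappa> / 2 * exp (r * t)) \<le> exp (- x * t) * ((r * t) ^ m * ?H)"
      using elim(1) by (intro mult_left_mono) auto
    with elim(2) have "(r * t) ^ m * 1 \<le> (r * t) ^ m * (exp (- x * t) * ?H)"
      by (simp only: mult_ac)
    then show ?case using rt by (simp add: mult_ac)
  qed
  with \<sigma> show thesis by (rule that)
qed

lemma pochhammer_nonpos_Int_eventually_0: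
  fixes a :: real
  assumes "a \<in> \<int>\<^sub>\<le>\<^sub>0"
  obtains N where "\<And>n. n \<ge> N \<Longrightarrow> pochhammer a n = 0"
proof -
  obtain k where "a = - of_nat k" using assms by (auto elim: nonpos_Ints_cases')
  then show thesis by (intro that[of "Suc k"]) (auto simp: pochhammer_eq_0_iff)
qed

text \<open>
  In the terminating case the series is a polynomial with constant coefficient \<open>1\<close>. So it is not
  zero, and away from zero for large arguments, and the growing exponential does the rest.
\<close>
lemma exp_mult_2F2_terminating_eventually_large:
  fixes a1 a2 b1 b2 x r :: real
  assumes Q0: "\<And>n. n \<ge> N \<Longrightarrow> pochhammer a1 n * pochhammer a2 n / (pochhammer b1 n * pochhammer b2 n) = 0"
    and "0 < r" "x < 0"
  obtains \<sigma> :: real where "\<sigma> \<in> {1, -1}"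
    "\<forall>\<^sub>F t in at_top. 1 \<le> \<sigma> * (exp (- x * t) * hypergeo_2F2 a1 a2 b1 b2 (r * t))"
proof -
  let ?Q = "\<lambda>n. pochhammer a1 n * pochhammer a2 n / (pochhammer b1 n * pochhammer b2 n)"
  define p where "p = (\<Sum>n<N. monom (?Q n / fact n) n)"
  have H: "hypergeo_2F2 a1 a2 b1 b2 w = poly p w" for w
  proof -
    have "hypergeo_2F2 a1 a2 b1 b2 w = (\<Sum>n<N. ?Q n * (w ^ n / fact n))"
      unfolding hypergeo_2F2_def
    proof (rule suminf_finite)
      fix n assume "n \<notin> {..<N}"
      then have "?Q n = 0" by (intro Q0) simp
      then show "?Q n * (w ^ n / fact n) = 0" by (simp only: mult_zero_left)
    qed simp
    then show ?thesis by (simp add: p_def poly_sum poly_monom)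
  qed
  have "0 < N" using Q0[of 0] by (cases N) auto
  then have "coeff p 0 = 1"
    by (simp add: p_def coeff_sum sum.remove[of _ 0])
  then have "p \<noteq> 0" by auto
  define \<sigma> where "\<sigma> = sgn (lead_coeff p)"
  have \<sigma>: "\<sigma> \<in> {1, -1}" using \<open>p \<noteq> 0\<close> by (auto simp: \<sigma>_def sgn_real_def)
  have pos: "0 < lead_coeff (smult \<sigma> p)"
  proof -
    have "lead_coeff (smult \<sigma> p) = \<bar>lead_coeff p\<bar>"
      unfolding lead_coeff_smult \<sigma>_def abs_sgn by (rule mult.commute)
    then show ?thesis using \<open>p \<noteq> 0\<close> by simp
  qed
  then obtain n where n: "\<And>w. w \<ge> n \<Longrightarrow> lead_coeff (smult \<sigma> p) \<le> poly (smult \<sigma> p) w"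
    using poly_pinfty_gt_lc by blast
  let ?l = "lead_coeff (smult \<sigma> p)"
  have "\<forall>\<^sub>F t in at_top. 1 \<le> exp (- x * t) * ?l"
    using pos \<open>x < 0\<close> by real_asymp
  moreover have "\<forall>\<^sub>F t in at_top. n \<le> r * t"
    using \<open>0 < r\<close> by real_asymp
  ultimately have "\<forall>\<^sub>F t in at_top. 1 \<le> \<sigma> * (exp (- x * t) * hypergeo_2F2 a1 a2 b1 b2 (r * t))"
  proof eventually_elim
    case (elim t)
    have "exp (- x * t) * ?l \<le> exp (- x * t) * poly (smult \<sigma> p) (r * t)"
      using n[OF elim(2)] by (intro mult_left_mono) auto
    then show ?case using elim(1) by (simp add: H mult_ac)
  qed
  with \<sigma> show thesis by (rule that)
qed

section \<open>The integral representation\<close>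

theorem proposition4:
  fixes a b c x y :: real and z :: complex
  assumes "c \<notin> \<int>\<^sub>\<le>\<^sub>0"
    and "z = Complex x y" and "x \<noteq> 0" and "y \<noteq> 0"
    and "norm z < 1 \<or> norm z = 1 \<and> c - a - b > 0"
  defines "f \<equiv> \<lambda>t. exp (- x * t) * cos (y * t)
                    * hypergeo_2F2 (a + 1) (b + 1) (c + 1) 2 ((norm z)\<^sup>2 * t)"
    and "g \<equiv> \<lambda>t. exp (- x * t) * sin (y * t)
                    * hypergeo_2F2 (a + 1) (b + 1) (c + 1) 2 ((norm z)\<^sup>2 * t)"
  shows "(f integrable_on {0..} \<longrightarrow>
            Re (hypergeo_2F1 (of_real a) (of_real b) (of_real c) z)
              = 1 + (norm z)\<^sup>2 * (a * b / c) * integral {0..} f) \<and>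
         (g integrable_on {0..} \<longrightarrow>
            Im (hypergeo_2F1 (of_real a) (of_real b) (of_real c) z)
              = (norm z)\<^sup>2 * (a * b / c) * integral {0..} g) \<and>
         ((norm z)\<^sup>2 < x \<longrightarrow> f integrable_on {0..} \<and> g integrable_on {0..})"
proof -
  define r where "r = (norm z)\<^sup>2"
  let ?H = "\<lambda>t. hypergeo_2F2 (a + 1) (b + 1) (c + 1) 2 (r * t)"
  let ?F = "hypergeo_2F1 (of_real a) (of_real b) (of_real c) :: complex \<Rightarrow> complex"
  let ?Q = "\<lambda>n. pochhammer (a + 1) n * pochhammer (b + 1) n / (pochhammer (c + 1) n * pochhammer 2 n)"
  let ?C = "r * (a * b / c)"
  have f: "f t = cos (y * t) * (exp (- x * t) * ?H t)" and g: "g t = sin (y * t) * (exp (- x * t) * ?H t)" for t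
    by (simp_all add: f_def g_def r_def)
  have z: "z \<noteq> 0" using \<open>z = Complex x y\<close> \<open>x \<noteq> 0\<close> by (auto simp: complex_eq_iff)
  have "0 < r" using z by (simp add: r_def)
  have r_eq: "r = x\<^sup>2 + y\<^sup>2" using \<open>z = Complex x y\<close> by (simp add: r_def cmod_power2)
  have z_eq: "of_real r / cnj z = z"
    unfolding r_def complex_norm_square using z by simp
  \<comment> \<open>Damping by \<open>\<epsilon>\<close> moves the rate from \<open>cnj z\<close> to \<open>cnj z + \<epsilon>\<close>. The rate is the conjugate of \<open>z\<close>
     because \<open>r / cnj z = z\<close>, and it also makes the imaginary part of the kernel a positive
     multiple of \<open>sin (y t)\<close>.\<close>
  have damped: "(\<lambda>t. exp (- \<epsilon> * t) * f t) integrable_on {0..}" (is ?fI)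
      "(\<lambda>t. exp (- \<epsilon> * t) * g t) integrable_on {0..}" (is ?gI)
      "?F (of_real r / (cnj z + of_real \<epsilon>)) = Complex
          (1 + ?C * integral {0..} (\<lambda>t. exp (- \<epsilon> * t) * f t))
          (?C * integral {0..} (\<lambda>t. exp (- \<epsilon> * t) * g t))" (is ?eq)
    if pos: "0 < x + \<epsilon>" and sm: "summable (\<lambda>n. \<bar>?Q n\<bar> * (r / (x + \<epsilon>)) ^ n)" for \<epsilon>
  proof -
    let ?s = "cnj z + of_real \<epsilon>"
    have Re_s: "Re ?s = x + \<epsilon>" using \<open>z = Complex x y\<close> by simp
    obtain J where J: "((\<lambda>t. exp (- ?s * of_real t) * of_real (?H t)) has_integral J) {0..}"
      and F: "?F (of_real r / ?s) = 1 + of_real ?C * J"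
      by (rule has_integral_laplace_2F2[of ?s r a b c])
         (use pos sm \<open>0 < r\<close> Re_s in auto)
    have Re_integrand: "Re (exp (- ?s * of_real t) * of_real (?H t)) = exp (- \<epsilon> * t) * f t"
      and Im_integrand: "Im (exp (- ?s * of_real t) * of_real (?H t)) = exp (- \<epsilon> * t) * g t" for t
      using \<open>z = Complex x y\<close>
      by (simp_all add: f g Re_exp Im_exp algebra_simps flip: exp_add)
    have "((\<lambda>t. exp (- \<epsilon> * t) * f t) has_integral Re J) {0..}"
      using has_integral_linear[OF J bounded_linear_Re] by (simp only: o_def Re_integrand)
    moreover have "((\<lambda>t. exp (- \<epsilon> * t) * g t) has_integral Im J) {0..}"
      using has_integral_linear[OF J bounded_linear_Im] by (simp only: o_def Im_integrand)
    ultimately show ?fI ?gI ?eq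
      by (auto simp: F complex_eq_iff integral_unique)
  qed
  have direct: "f integrable_on {0..}" "g integrable_on {0..}"
      "?F z = Complex (1 + ?C * integral {0..} f) (?C * integral {0..} g)"
    if "0 < x" "summable (\<lambda>n. \<bar>?Q n\<bar> * (r / x) ^ n)"
    using damped[of 0] that z_eq by simp_all
  have sm: "summable (\<lambda>n. \<bar>?Q n\<bar> * (r / u) ^ n)" if "r < u" for u
    by (rule summable_pochhammer_quotient) (use that \<open>0 < r\<close> in auto)
  \<comment> \<open>On the circle \<open>x = r\<close> the coefficient series need not converge, so the integrals are reached
     by letting \<open>\<epsilon>\<close> tend to \<open>0\<close>. There \<open>norm z < 1\<close> since \<open>y \<noteq> 0\<close>, so the Gauss series is
     continuous at \<open>z\<close>.\<close>
  have boundary: "(f integrable_on {0..} \<longrightarrow> Re (?F z) = 1 + ?C * integral {0..} f) \<and>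
     (g integrable_on {0..} \<longrightarrow> Im (?F z) = ?C * integral {0..} g)" if "x = r"
  proof -
    have "0 < x" using that \<open>0 < r\<close> by simp
    have "x * x < x * 1"
      using that r_eq \<open>y \<noteq> 0\<close> by (simp add: power2_eq_square)
         (metis less_add_same_cancel1 zero_less_mult_iff linorder_neqE_linordered_idom)
    then have "r < 1" using \<open>0 < x\<close> that by simp
    then have "norm z < 1" unfolding r_def by (simp add: power_less_one_iff)
    then obtain \<rho> where \<rho>: "norm z < \<rho>" "\<rho> < 1" using dense by blast
    have "isCont ?F z"
    proof -
      let ?A = "\<lambda>n. pochhammer a n * pochhammer b n / (pochhammer c n * pochhammer 1 n)"
      have "0 \<le> \<rho>" using \<rho> norm_ge_zero[of z] by linarith
      have "summable (\<lambda>n. of_real (?A n) * of_real \<rho> ^ n :: complex)"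
        by (rule summable_norm_cancel)
           (use summable_pochhammer_quotient[OF \<open>0 \<le> \<rho>\<close> \<rho>(2), of a b c 1] \<open>0 \<le> \<rho>\<close>
             in \<open>simp add: norm_mult norm_divide norm_power abs_mult\<close>)
      then have "isCont (\<lambda>w. \<Sum>n. of_real (?A n) * w ^ n :: complex) z"
        by (rule isCont_powser) (use \<rho> in auto)
      moreover have "?F = (\<lambda>w. \<Sum>n. of_real (?A n) * w ^ n)"
        by (simp add: fun_eq_iff hypergeo_2F1_def pochhammer_of_real pochhammer_fact[symmetric])
      ultimately show ?thesis by (simp only:)
    qed
    have "((\<lambda>\<epsilon>. of_real r / (cnj z + of_real \<epsilon>)) \<longlongrightarrow> of_real r / (cnj z + of_real 0)) (at_right 0)"
      using z by (intro tendsto_intros) auto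
    then have lim: "((\<lambda>\<epsilon>. ?F (of_real r / (cnj z + of_real \<epsilon>))) \<longlongrightarrow> ?F z) (at_right 0)"
      using isCont_tendsto_compose[OF \<open>isCont ?F z\<close>] z_eq by simp
    have dampedI: "(\<lambda>t. exp (- \<epsilon> * t) * f t) integrable_on {0..}"
        "(\<lambda>t. exp (- \<epsilon> * t) * g t) integrable_on {0..}"
        "?F (of_real r / (cnj z + of_real \<epsilon>)) = Complex
          (1 + ?C * integral {0..} (\<lambda>t. exp (- \<epsilon> * t) * f t))
          (?C * integral {0..} (\<lambda>t. exp (- \<epsilon> * t) * g t))" if "0 < \<epsilon>" for \<epsilon>
      using damped[of \<epsilon>] sm[of "x + \<epsilon>"] that \<open>x = r\<close> \<open>0 < x\<close> by auto
    have "((\<lambda>\<epsilon>. 1 + ?C * integral {0..} (\<lambda>t. exp (- \<epsilon> * t) * f t)) \<longlongrightarrow> Re (?F z)) (at_right 0)"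
      by (rule Lim_transform_eventually[OF tendsto_Re[OF lim]])
         (use eventually_at_right_less in eventually_elim, simp add: dampedI)
    moreover have "((\<lambda>\<epsilon>. ?C * integral {0..} (\<lambda>t. exp (- \<epsilon> * t) * g t)) \<longlongrightarrow> Im (?F z)) (at_right 0)"
      by (rule Lim_transform_eventually[OF tendsto_Im[OF lim]])
         (use eventually_at_right_less in eventually_elim, simp add: dampedI)
    moreover have "((\<lambda>\<epsilon>. 1 + ?C * integral {0..} (\<lambda>t. exp (- \<epsilon> * t) * f t)) \<longlongrightarrow> 1 + ?C * integral {0..} f) (at_right 0)"
      if "f integrable_on {0..}"
      by (intro tendsto_add tendsto_mult tendsto_const integral_exp_damped_tendsto that dampedI)
    moreover have "((\<lambda>\<epsilon>. ?C * integral {0..} (\<lambda>t. exp (- \<epsilon> * t) * g t)) \<longlongrightarrow> ?C * integral {0..} g) (at_right 0)"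
      if "g integrable_on {0..}"
      by (intro tendsto_mult tendsto_const integral_exp_damped_tendsto that dampedI)
    ultimately show ?thesis
      using tendsto_unique[OF trivial_limit_at_right_real] by blast
  qed
  \<comment> \<open>If the factor without oscillation stays away from zero with a fixed sign, both implications
     are vacuous.\<close>
  have divergent: "\<not> f integrable_on {0..} \<and> \<not> g integrable_on {0..}"
    if "\<sigma> \<in> {1, -1}" "\<forall>\<^sub>F t in at_top. 1 \<le> \<sigma> * (exp (- x * t) * ?H t)" for \<sigma>
    unfolding f g using not_integrable_trig_mult[OF \<open>y \<noteq> 0\<close> that] by blast
  have "(f integrable_on {0..} \<longrightarrow> Re (?F z) = 1 + ?C * integral {0..} f) \<and>
        (g integrable_on {0..} \<longrightarrow> Im (?F z) = ?C * integral {0..} g)"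
  proof (cases "a + 1 \<in> \<int>\<^sub>\<le>\<^sub>0 \<or> b + 1 \<in> \<int>\<^sub>\<le>\<^sub>0")
    case True
    then obtain N where N: "\<And>n. n \<ge> N \<Longrightarrow> ?Q n = 0"
      by (metis pochhammer_nonpos_Int_eventually_0 div_0 mult_zero_left mult_zero_right)
    show ?thesis
    proof (cases "0 < x")
      case True
      have "summable (\<lambda>n. \<bar>?Q n\<bar> * (r / x) ^ n)"
        by (rule summable_finite[of "{..<N}"]) (use N in \<open>auto simp: not_less simp del: divide_eq_0_iff mult_eq_0_iff\<close>)
      from direct[OF True this] show ?thesis by simp
    next
      case False
      then have "x < 0" using \<open>x \<noteq> 0\<close> by simp
      then obtain \<sigma> :: real where "\<sigma> \<in> {1, -1}" "\<forall>\<^sub>F t in at_top. 1 \<le> \<sigma> * (exp (- x * t) * ?H t)"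
        using exp_mult_2F2_terminating_eventually_large[OF N \<open>0 < r\<close>] by blast
      from divergent[OF this] show ?thesis by blast
    qed
  next
    case False
    consider "r < x" | "x = r" | "x < r" by linarith
    then show ?thesis
    proof cases
      case 1
      then show ?thesis using direct[OF _ sm] \<open>0 < r\<close> by simp
    next
      case 2
      then show ?thesis by (rule boundary)
    next
      case 3
      have "c + 1 \<notin> \<int>\<^sub>\<le>\<^sub>0"
      proof
        assume "c + 1 \<in> \<int>\<^sub>\<le>\<^sub>0"
        then have "c + 1 - 1 \<in> \<int>\<^sub>\<le>\<^sub>0" by (rule nonpos_Ints_diff_Nats) simp
        with \<open>c \<notin> \<int>\<^sub>\<le>\<^sub>0\<close> show False by simp
      qed
      moreover have "(2::real) \<notin> \<int>\<^sub>\<le>\<^sub>0" by (auto elim: nonpos_Ints_cases)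
      ultimately obtain \<sigma> :: real where "\<sigma> \<in> {1, -1}" "\<forall>\<^sub>F t in at_top. 1 \<le> \<sigma> * (exp (- x * t) * ?H t)"
        using exp_mult_2F2_eventually_large[of "a + 1" "b + 1" "c + 1" 2 r x] False \<open>0 < r\<close> 3 by blast
      from divergent[OF this] show ?thesis by blast
    qed
  qed
  moreover have "f integrable_on {0..} \<and> g integrable_on {0..}" if "r < x"
    using direct[OF _ sm] \<open>0 < r\<close> that by simp
  ultimately show ?thesis unfolding r_def by blast
qed

end
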